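(* Let $K$ be a convex polyhedron, with $n_0$ vertices, $n_1$ edges and $n_2$ two-dimensional polygons (faces). Then $$n_0 - n_1 + n_2 = 2.$$
   Context: A polyhedron is a three-dimensional solid figure in $\mathbb{R}^3$ constructed from polygons (its two-dimensional faces) in such a way that each edge is the common face of exactly two two-dimensional polygons and each vertex is the common face of at least three edges. *)

theory Defs
  imports "HOL-Analysis.Analysis"
begin

definition polygon_of :: "'a::euclidean_space set \<Rightarrow> 'a set \<Rightarrow> bool"  (infixr \<open>(polygon'_of)\<close> 50)
  where "F polygon_of K \<longleftrightarrow> F face_of K \<and> aff_dim F = 2"

text \<open>
  A convex solid whose boundary is made up of finitely many polygons, each edge lying on exactly
  two of them and each vertex on at least three edges. This is not the library's predicate
  \<^const>\<open>polyhedron\<close>, which also admits unbounded and lower-dimensional sets;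
  \<open>convex_polyhedron_iff_polytope\<close> below identifies it with the three-dimensional polytopes.
\<close>

definition convex_polyhedron :: "(real^3) set \<Rightarrow> bool"
  where "convex_polyhedron K \<longleftrightarrow>
    convex K \<and> compact K \<and> interior K \<noteq> {} \<and>
    finite {F. F polygon_of K} \<and> (\<forall>F. F polygon_of K \<longrightarrow> polytope F) \<and>
    frontier K = \<Union>{F. F polygon_of K} \<and>
    (\<forall>e. e edge_of K \<longrightarrow> card {F. F polygon_of K \<and> e face_of F} = 2) \<and>
    (\<forall>v. v extreme_point_of K \<longrightarrow> card {e. e edge_of K \<and> {v} face_of e} \<ge> 3)"

lemma polyhedron_ridge_dependent:
  fixes K :: "'a::euclidean_space set" and a :: "3 \<Rightarrow> 'a"
  assumes EK: "E \<subseteq> K" and z: "z \<in> E" and dim: "aff_dim E = aff_dim K - 2"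
    and orth: "\<And>i x. x \<in> E \<Longrightarrow> a i \<bullet> (x - z) = 0"
  obtains c :: "real^3" where "c \<noteq> 0" "\<And>x. x \<in> K \<Longrightarrow> (\<Sum>i\<in>UNIV. c $ i * (a i \<bullet> (x - z))) = 0"
proof -
  define f :: "'a \<Rightarrow> real^3" where "f = (\<lambda>x. \<chi> i. a i \<bullet> x)"
  have lin: "linear f"
    unfolding f_def by (rule linearI) (simp_all add: vec_eq_iff inner_right_distrib)
  define V where "V = span ((+) (- z) ` K)"
  have dV: "aff_dim K = int (dim V)"
    unfolding V_def dim_span by (rule aff_dim_eq_dim) (meson EK hull_inc subsetD z)
  have dE: "aff_dim E = int (dim ((+) (- z) ` E))"
    by (rule aff_dim_eq_dim) (simp add: hull_inc z)
  define W where "W = span ((+) (- z) ` E)"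
  define C where "C = {y \<in> V. \<forall>x \<in> W. orthogonal x y}"
  have WV: "W \<subseteq> V" unfolding W_def V_def using EK by (intro span_mono image_mono)
  have sp: "subspace W" "subspace V" by (simp_all add: W_def V_def)
  have f0: "f w = 0" if "w \<in> W" for w
    using that unfolding W_def
  proof (rule span_induct)
    show "subspace {w. f w = 0}" using linear_subspace_kernel[OF lin] .
    show "f w = 0" if "w \<in> (+) (- z) ` E" for w
      using that orth by (auto simp: f_def vec_eq_iff)
  qed
  have "f ` V \<subseteq> f ` C"
  proof (rule image_subsetI)
    fix y assume y: "y \<in> V"
    obtain w u where wu: "w \<in> span W" "\<And>x. x \<in> span W \<Longrightarrow> orthogonal u x" "y = w + u"
      using orthogonal_subspace_decomp_exists[of W y] by blast
    have w: "w \<in> W" using wu(1) sp(1) by (metis span_eq_iff)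
    then have "u \<in> V" using y wu(3) WV sp(2) by (metis add_diff_cancel_left' subsetD subspace_diff)
    then have "u \<in> C" using wu(2) by (auto simp: C_def orthogonal_commute span_base)
    moreover have "f y = f u" using wu(3) f0[OF w] linear_add[OF lin] by simp
    ultimately show "f y \<in> f ` C" by blast
  qed
  then have "dim (f ` V) \<le> dim (f ` C)" by (rule dim_subset)
  also have "\<dots> \<le> dim C" by (rule dim_image_le[OF lin])
  finally have "dim (f ` V) \<le> dim C" .
  moreover have "dim C + dim W = dim V"
    unfolding C_def by (rule dim_subspace_orthogonal_to_vectors[OF sp WV])
  moreover have "aff_dim E = int (dim W)" using dE by (simp add: W_def)
  ultimately have "dim (f ` V) < DIM(real^3)"
    using dV dim by simp
  then obtain c where c: "c \<noteq> 0" "\<And>y. y \<in> span (f ` V) \<Longrightarrow> orthogonal c y"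
    using orthogonal_to_subspace_exists by blast
  have "(\<Sum>i\<in>UNIV. c $ i * (a i \<bullet> (x - z))) = 0" if "x \<in> K" for x
  proof -
    have "x - z \<in> V" unfolding V_def using that by (intro span_base) (auto simp: image_iff)
    then have "orthogonal c (f (x - z))" by (intro c(2) span_base) auto
    then show ?thesis by (simp add: orthogonal_def inner_vec_def f_def)
  qed
  with c(1) that show thesis by blast
qed

lemma facet_eq_if_subset:
  fixes K :: "'a::euclidean_space set"
  assumes "convex K" "F facet_of K" "G facet_of K" "F \<subseteq> G"
  shows "F = G"
proof (rule ccontr)
  assume "F \<noteq> G"
  have "F face_of G" using assms by (meson face_of_face facet_of_imp_face_of)
  then have "aff_dim F < aff_dim G"
    using face_of_aff_dim_lt \<open>F \<noteq> G\<close> assms face_of_imp_convex facet_of_imp_face_of by blast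
  then show False using assms unfolding facet_of_def by simp
qed

lemma polyhedron_ridge_two_facets:
  fixes K :: "'a::euclidean_space set"
  assumes K: "polyhedron K" and E: "E face_of K" "E \<noteq> {}" and dim: "aff_dim E = aff_dim K - 2"
  shows "card {F. F facet_of K \<and> E \<subseteq> F} = 2"
proof -
  let ?H = "{F. F facet_of K \<and> E \<subseteq> F}"
  have cK: "convex K" using K by (simp add: polyhedron_imp_convex)
  have "E \<noteq> K" using dim by auto
  then have EI: "E = \<Inter>?H" by (intro face_of_polyhedron K E)
  have fin: "finite ?H"
    using finite_polyhedron_facets[OF K] by (rule rev_finite_subset) auto
  have "?H \<noteq> {}"
    using face_of_polyhedron_subset_facet[OF K E \<open>E \<noteq> K\<close>] by blast
  moreover have "?H \<noteq> {F}" for F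
  proof
    assume *: "?H = {F}"
    then have "E = F" "F facet_of K" using EI by auto
    then show False using dim unfolding facet_of_def by simp
  qed
  ultimately have ge: "card ?H \<noteq> 0" "card ?H \<noteq> 1"
    using fin by (auto simp: card_1_singleton_iff)
  have le: False if gt: "card ?H > 2"
  proof -
    from gt have "3 \<le> card ?H" by simp
    then obtain T where T: "T \<subseteq> ?H" "card T = 3" and "finite T"
      by (rule obtain_subset_with_card_n)
    have "card (UNIV :: 3 set) = card T" using T by simp
    then obtain G :: "3 \<Rightarrow> 'a set" where G: "bij_betw G UNIV T"
      using finite_same_card_bij[OF finite \<open>finite T\<close>] by blast
    have GH: "G i facet_of K" "E \<subseteq> G i" for i
      using G T by (auto simp: bij_betw_def)
    have Gne: "G i \<noteq> G j" if "i \<noteq> j" for i j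
      using G that by (auto simp: bij_betw_def inj_on_def)
    have "\<exists>a b. K \<subseteq> {x. a \<bullet> x \<le> b} \<and> G i = K \<inter> {x. a \<bullet> x = b}" for i
      using facet_of_polyhedron[OF K GH(1)] by metis
    then obtain a b where ab: "\<And>i. K \<subseteq> {x. a i \<bullet> x \<le> b i}" "\<And>i. G i = K \<inter> {x. a i \<bullet> x = b i}"
      by metis
    obtain z where z: "z \<in> E" using E by blast
    have zb: "a i \<bullet> z = b i" for i using z GH(2) ab(2) by blast
    obtain c where c: "c \<noteq> 0" "\<And>x. x \<in> K \<Longrightarrow> (\<Sum>i\<in>UNIV. c $ i * (a i \<bullet> (x - z))) = 0"
    proof (rule polyhedron_ridge_dependent[of E K z a])
      show "E \<subseteq> K" using E by (simp add: face_of_imp_subset)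
      show "a i \<bullet> (x - z) = 0" if "x \<in> E" for i x
        using that GH(2)[of i] ab(2)[of i] zb[of i] by (auto simp: inner_diff_right)
    qed (use z dim in auto)
    have "\<exists>x \<in> G i. \<forall>j. j \<noteq> i \<longrightarrow> x \<notin> G j" for i
    proof -
      have "convex (G i)" "G i \<noteq> {}"
        using GH(1) facet_of_def face_of_imp_convex by blast+
      then obtain x where x: "x \<in> rel_interior (G i)"
        by (meson ex_in_conv rel_interior_eq_empty)
      have "x \<notin> G j" if "j \<noteq> i" for j
      proof
        assume "x \<in> G j"
        then have "G i \<subseteq> G j"
          using x GH(1) by (intro subset_of_face_of[of "G j" K "G i"])
            (auto simp: facet_of_imp_face_of facet_of_imp_subset)
        then show False using facet_eq_if_subset[OF cK] GH(1) Gne that by metis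
      qed
      then show ?thesis using x rel_interior_subset by blast
    qed
    then obtain x where x: "\<And>i. x i \<in> G i" "\<And>i j. j \<noteq> i \<Longrightarrow> x i \<notin> G j" by metis
    have xK: "x i \<in> K" for i using x(1) ab(2) by blast
    have eq: "a i \<bullet> (x i - z) = 0" for i
      using x(1)[of i] ab(2)[of i] zb[of i] by (auto simp: inner_diff_right)
    have lt: "a j \<bullet> (x i - z) < 0" if "j \<noteq> i" for i j
    proof -
      have "a j \<bullet> x i \<le> b j" "a j \<bullet> x i \<noteq> b j"
        using ab(1)[of j] ab(2)[of j] xK[of i] x(2)[OF that] by auto
      then show ?thesis using zb[of j] by (simp add: inner_diff_right)
    qed
    have s: "c$1 * (a 1 \<bullet> (x i - z)) + c$2 * (a 2 \<bullet> (x i - z)) + c$3 * (a 3 \<bullet> (x i - z)) = 0" for i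
      using c(2)[OF xK[of i]] by (simp add: sum_3)
    have opp: "p * q \<le> 0 \<and> (p = 0 \<longleftrightarrow> q = 0)" if "p * r + q * t = 0" "r < 0" "t < 0" for p q r t :: real
    proof -
      define m where "m = - r / t"
      have q: "q = p * m" using that by (simp add: m_def field_simps)
      have "m < 0" using that by (simp add: m_def divide_neg_neg)
      moreover have "p * q = (p * p) * m" by (simp add: q)
      ultimately have "p * q \<le> 0" by (metis less_imp_le mult_nonneg_nonpos zero_le_square)
      then show ?thesis using q \<open>m < 0\<close> by simp
    qed
    have ne: "(1::3) \<noteq> 2" "(1::3) \<noteq> 3" "(2::3) \<noteq> 3" by simp_all
    have "c$2 * c$3 \<le> 0 \<and> (c$2 = 0 \<longleftrightarrow> c$3 = 0)"
      using s[of 1] eq[of 1] lt[of 2 1] lt[of 3 1] ne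
      by (intro opp[where r = "a 2 \<bullet> (x 1 - z)" and t = "a 3 \<bullet> (x 1 - z)"]) auto
    moreover have "c$1 * c$3 \<le> 0 \<and> (c$1 = 0 \<longleftrightarrow> c$3 = 0)"
      using s[of 2] eq[of 2] lt[of 1 2] lt[of 3 2] ne
      by (intro opp[where r = "a 1 \<bullet> (x 2 - z)" and t = "a 3 \<bullet> (x 2 - z)"]) auto
    moreover have "c$1 * c$2 \<le> 0 \<and> (c$1 = 0 \<longleftrightarrow> c$2 = 0)"
      using s[of 3] eq[of 3] lt[of 1 3] lt[of 2 3] ne
      by (intro opp[where r = "a 1 \<bullet> (x 3 - z)" and t = "a 2 \<bullet> (x 3 - z)"]) auto
    ultimately have "c$1 = 0 \<and> c$2 = 0 \<and> c$3 = 0"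
      by (auto simp: mult_le_0_iff)
    then show False using c(1) by (simp add: vec_eq_iff forall_3)
  qed
  from ge le show ?thesis by fastforce
qed

lemma polygon_of_iff_facet_of:
  "aff_dim K = 3 \<Longrightarrow> F polygon_of K \<longleftrightarrow> F facet_of K"
  unfolding polygon_of_def facet_of_def by auto

lemma edge_of_iff_facet_of_polygon:
  assumes "F face_of K" "aff_dim F = 2"
  shows "e edge_of K \<and> e \<subseteq> F \<longleftrightarrow> e facet_of F"
  using assms face_of_face[OF assms(1), of e] unfolding edge_of_def facet_of_def by auto

lemma polytope_vertex_three_edges:
  fixes K :: "'a::euclidean_space set"
  assumes K: "polytope K" and dim: "aff_dim K = 3" and v: "v extreme_point_of K"
  shows "3 \<le> card {e. e edge_of K \<and> {v} face_of e}"
proof -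
  have pK: "polyhedron K" using K by (simp add: polytope_imp_polyhedron)
  have cK: "convex K" using K by (simp add: polytope_imp_convex)
  have vK: "{v} face_of K" using v by (simp add: face_of_singleton)
  have poly: "card {e. e edge_of K \<and> v \<in> e \<and> e \<subseteq> F} = 2"
    if F: "F facet_of K" "v \<in> F" for F
  proof -
    have FK: "F face_of K" "aff_dim F = 2" using F dim by (auto simp: facet_of_def)
    have "{v} face_of F" using vK F face_of_face[OF FK(1)] by auto
    then have "card {e. e facet_of F \<and> {v} \<subseteq> e} = 2"
      using FK pK by (intro polyhedron_ridge_two_facets) (auto intro: face_of_polyhedron_polyhedron)
    moreover have "{e. e facet_of F \<and> {v} \<subseteq> e} = {e. e edge_of K \<and> v \<in> e \<and> e \<subseteq> F}"
      using edge_of_iff_facet_of_polygon[OF FK] by auto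
    ultimately show ?thesis by simp
  qed
  have "{v} \<noteq> K" using dim by auto
  then obtain F1 where F1: "F1 facet_of K" "v \<in> F1"
    using face_of_polyhedron_subset_facet[OF pK vK] by auto
  obtain e1 e2 where e12: "{e. e edge_of K \<and> v \<in> e \<and> e \<subseteq> F1} = {e1, e2}" "e1 \<noteq> e2"
    using poly[OF F1] by (meson card_2_iff)
  then have e1: "e1 edge_of K" "v \<in> e1" "e1 \<subseteq> F1" and e2: "e2 edge_of K" "v \<in> e2" "e2 \<subseteq> F1"
    by blast+
  have two: "card {F. F facet_of K \<and> e1 \<subseteq> F} = 2"
    using e1 dim pK by (intro polyhedron_ridge_two_facets) (auto simp: edge_of_def)
  obtain F2 where F2: "F2 facet_of K" "e1 \<subseteq> F2" "F2 \<noteq> F1"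
  proof -
    obtain P Q where "{F. F facet_of K \<and> e1 \<subseteq> F} = {P, Q}" "P \<noteq> Q"
      using two by (meson card_2_iff)
    then have PQ: "P facet_of K \<and> e1 \<subseteq> P" "Q facet_of K \<and> e1 \<subseteq> Q"
      by (simp_all add: set_eq_iff)
    show thesis using PQ \<open>P \<noteq> Q\<close> that[of P] that[of Q] by metis
  qed
  have "v \<in> F2" using e1 F2 by blast
  obtain e3 where e3: "e3 edge_of K" "v \<in> e3" "e3 \<subseteq> F2" "e3 \<noteq> e1"
  proof -
    obtain P Q where "{e. e edge_of K \<and> v \<in> e \<and> e \<subseteq> F2} = {P, Q}" "P \<noteq> Q"
      using poly[OF F2(1) \<open>v \<in> F2\<close>] by (meson card_2_iff)
    then have PQ: "P edge_of K \<and> v \<in> P \<and> P \<subseteq> F2" "Q edge_of K \<and> v \<in> Q \<and> Q \<subseteq> F2"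
      by (simp_all add: set_eq_iff)
    show thesis using PQ \<open>P \<noteq> Q\<close> that[of P] that[of Q] by metis
  qed
  have I: "F1 \<inter> F2 face_of F1"
    using F1 F2 by (meson face_of_Int face_of_face facet_of_imp_face_of inf_le1)
  have "F1 \<inter> F2 \<noteq> F1"
    using facet_eq_if_subset[OF cK F1(1) F2(1)] F2(3) by blast
  then have "aff_dim (F1 \<inter> F2) < aff_dim F1"
    using I F1 face_of_aff_dim_lt face_of_imp_convex facet_of_imp_face_of by metis
  then have dI: "aff_dim (F1 \<inter> F2) \<le> 1" using F1 dim by (auto simp: facet_of_def)
  have "F1 \<inter> F2 face_of K" using F1 F2 by (simp add: face_of_Int facet_of_imp_face_of)
  have whole: "e = F1 \<inter> F2" if "e edge_of K" "e \<subseteq> F1" "e \<subseteq> F2" for e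
  proof (rule ccontr)
    assume "e \<noteq> F1 \<inter> F2"
    moreover have "e face_of F1 \<inter> F2"
      using that face_of_face[OF \<open>F1 \<inter> F2 face_of K\<close>] by (auto simp: edge_of_def)
    ultimately have "aff_dim e < aff_dim (F1 \<inter> F2)"
      using face_of_aff_dim_lt \<open>F1 \<inter> F2 face_of K\<close> face_of_imp_convex by blast
    then show False using that dI by (simp add: edge_of_def)
  qed
  have "e3 \<noteq> e2"
    using whole[OF e1(1) e1(3) F2(2)] whole[of e2] e2 e3 e12(2) by metis
  then have "card {e1, e2, e3} = 3" using e12 e3 by auto
  moreover have "{e1, e2, e3} \<subseteq> {e. e edge_of K \<and> {v} face_of e}"
    using e1 e2 e3 vK by (auto simp: edge_of_def face_of_face)
  moreover have "finite {e. e edge_of K \<and> {v} face_of e}"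
    using finite_polytope_faces[OF K] by (rule rev_finite_subset) (auto simp: edge_of_def)
  ultimately show ?thesis by (metis card_mono)
qed

theorem convex_polyhedron_iff_polytope:
  "convex_polyhedron K \<longleftrightarrow> polytope K \<and> aff_dim K = 3"
proof
  assume K: "convex_polyhedron K"
  have dim: "aff_dim K = 3"
    using K aff_dim_nonempty_interior[of K] by (simp add: convex_polyhedron_def)
  let ?V = "{x. x extreme_point_of K}"
  have "?V \<subseteq> (\<Union>F\<in>{F. F polygon_of K}. {x. x extreme_point_of F})"
  proof
    fix x assume "x \<in> ?V"
    then have x: "x extreme_point_of K" by simp
    then have "x \<notin> interior K" "x \<in> K"
      by (auto simp: extreme_point_not_in_interior extreme_point_of_def)
    then have "x \<in> frontier K" using closure_subset by (auto simp: frontier_def)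
    then obtain F where F: "F polygon_of K" "x \<in> F" using K by (auto simp: convex_polyhedron_def)
    then have "x extreme_point_of F"
      using x extreme_point_of_face[of F K] by (auto simp: polygon_of_def)
    with F show "x \<in> (\<Union>F\<in>{F. F polygon_of K}. {x. x extreme_point_of F})" by blast
  qed
  moreover have "finite (\<Union>F\<in>{F. F polygon_of K}. {x. x extreme_point_of F})"
    using K by (intro finite_UN_I)
      (simp_all add: convex_polyhedron_def finite_polyhedron_extreme_points polytope_imp_polyhedron)
  ultimately have "finite ?V" by (rule finite_subset)
  moreover have "K = convex hull ?V"
    using K by (intro Krein_Milman_Minkowski) (auto simp: convex_polyhedron_def)
  ultimately show "polytope K \<and> aff_dim K = 3"
    using dim polytope_convex_hull by metis
next
  assume K: "polytope K \<and> aff_dim K = 3"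
  then have pK: "polyhedron K" by (simp add: polytope_imp_polyhedron)
  have cK: "convex K" using K by (simp add: polytope_imp_convex)
  have pf: "F polygon_of K \<longleftrightarrow> F facet_of K" for F
    using K polygon_of_iff_facet_of by blast
  have U: "affine hull K = UNIV" using K by (simp add: aff_dim_eq_full[symmetric])
  then have "interior K = rel_interior K" by (simp add: rel_interior_interior)
  moreover have "K \<noteq> {}" using K by auto
  ultimately have i: "interior K \<noteq> {}" using cK by (simp add: rel_interior_eq_empty)
  have fr: "frontier K = \<Union>{F. F facet_of K}"
    using rel_frontier_of_polyhedron[OF pK] \<open>interior K = rel_interior K\<close>
    by (simp add: rel_frontier_def frontier_def)
  have two: "card {F. F polygon_of K \<and> e face_of F} = 2" if e: "e edge_of K" for e
  proof -
    have "card {F. F facet_of K \<and> e \<subseteq> F} = 2"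
      using e K pK by (intro polyhedron_ridge_two_facets) (auto simp: edge_of_def)
    moreover have "F facet_of K \<Longrightarrow> e face_of F \<longleftrightarrow> e \<subseteq> F" for F
      using e face_of_face[of F K e] by (auto simp: edge_of_def facet_of_imp_face_of)
    ultimately show ?thesis by (simp add: pf cong: conj_cong)
  qed
  show "convex_polyhedron K"
    unfolding convex_polyhedron_def
    using K cK i fr two polytope_vertex_three_edges[of K] finite_polyhedron_facets[OF pK]
    by (auto simp: pf polytope_imp_compact facet_of_imp_face_of intro: face_of_polytope_polytope)
qed

end

theory Submission
  imports Defs
begin

text \<open>
  The alternating sum \<open>\<chi>(P)\<close> of \<open>(-1)^dim F\<close> over the nonempty faces \<open>F\<close> of any nonempty polytope
  \<open>P\<close>, with \<open>P\<close> itself included, is \<open>1\<close>; for \<open>dim P = 3\<close> this is the claim. Induct on \<open>dim P\<close>,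
  slicing \<open>P\<close> by the level sets of a linear functional \<open>h\<close> that is injective on the vertices.
  The nonempty faces of the slice \<open>h = t\<close> are the sections of the faces that cross the level \<open>t\<close>,
  one dimension lower, and the vertex at level \<open>t\<close> if there is one. As the slice has \<open>\<chi> = 1\<close>, the
  signed count of the faces crossing \<open>t\<close> is \<open>0\<close> at a vertex level and \<open>-1\<close> strictly between two
  consecutive vertex levels. Each face of positive dimension crosses exactly one more of the gaps
  between the \<open>m\<close> vertex levels than it crosses vertex levels, so these faces contribute
  \<open>-(m - 1)\<close> to \<open>\<chi>(P)\<close>, and the \<open>m\<close> vertices bring the total to \<open>1\<close>.
\<close>

text \<open>The Euler characteristic of the face complex. Leaving out the empty face, whose
  \<open>aff_dim\<close> is -1, ensures that \<open>nat\<close> does not truncate any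
  exponent.\<close>

definition face_char :: "'a::euclidean_space set \<Rightarrow> int"
  where "face_char P = (\<Sum>F | F face_of P \<and> F \<noteq> {}. (-1) ^ nat (aff_dim F))"

text \<open>Strictness on both sides excludes faces that merely touch the level set or lie inside
  it. A convex set that crosses has relative interior points on the hyperplane.\<close>

definition crosses :: "'a::euclidean_space \<Rightarrow> real \<Rightarrow> 'a set \<Rightarrow> bool"
  where "crosses a t F \<longleftrightarrow> (\<exists>x\<in>F. a \<bullet> x < t) \<and> (\<exists>y\<in>F. t < a \<bullet> y)"

section \<open>Generic functionals and the faces of a polytope\<close>

lemma aff_dim_nonneg:
  fixes S :: "'a::euclidean_space set"
  shows "S \<noteq> {} \<Longrightarrow> 0 \<le> aff_dim S"
  using aff_dim_geq[of S] aff_dim_empty[of S] by linarith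

text \<open>Each pair of distinct points excludes only the vectors of one hyperplane through the
  origin, and finitely many hyperplanes form a null set.\<close>

lemma exists_inner_inj_on:
  fixes V :: "'a::euclidean_space set"
  assumes "finite V"
  obtains a where "inj_on (\<lambda>x. a \<bullet> x) V"
proof -
  let ?N = "\<Union>(v, w)\<in>{(v, w). v \<in> V \<and> w \<in> V \<and> v \<noteq> w}. {a. (v - w) \<bullet> a = 0}"
  have "finite {(v, w). v \<in> V \<and> w \<in> V \<and> v \<noteq> w}"
    using assms by (rule_tac finite_subset[of _ "V \<times> V"]) auto
  then have "negligible ?N"
    by (intro negligible_Union finite_imageI) (auto intro!: negligible_hyperplane)
  then have "?N \<noteq> UNIV" by (metis non_negligible_UNIV)
  then obtain a where a: "a \<notin> ?N" by blast
  have "inj_on (\<lambda>x. a \<bullet> x) V"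
  proof (rule inj_onI, rule ccontr)
    fix v w assume "v \<in> V" "w \<in> V" "a \<bullet> v = a \<bullet> w" "v \<noteq> w"
    then have "(v - w) \<bullet> a = 0" by (simp add: inner_commute[of _ a] inner_diff_right)
    with a \<open>v \<in> V\<close> \<open>w \<in> V\<close> \<open>v \<noteq> w\<close> show False by blast
  qed
  then show thesis by (rule that)
qed

text \<open>A minimal face containing \<open>x\<close> works: if \<open>x\<close> were on its
  relative boundary, a smaller face would still contain \<open>x\<close>.\<close>

lemma polytope_point_in_rel_interior_face:
  fixes P :: "'a::euclidean_space set"
  assumes P: "polytope P" and "x \<in> P"
  obtains F where "F face_of P" "x \<in> rel_interior F"
proof -
  let ?S = "{F. F face_of P \<and> x \<in> F}"
  have "finite ?S" using finite_polytope_faces[OF P] by (rule rev_finite_subset) auto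
  moreover have "?S \<noteq> {}" using assms face_of_refl polytope_imp_convex by blast
  ultimately obtain F where F: "F \<in> ?S" and min: "\<And>G. G \<in> ?S \<Longrightarrow> \<not> G \<subset> F"
    using finite_has_minimal[of ?S] by (metis psubset_eq)
  have "polyhedron F"
    using F P face_of_polytope_polytope polytope_imp_polyhedron by blast
  have "x \<in> rel_interior F"
  proof (rule ccontr)
    assume "x \<notin> rel_interior F"
    then have "x \<in> rel_frontier F"
      using F closure_subset by (auto simp: rel_frontier_def)
    then obtain G where "G face_of F" "G \<noteq> F" "x \<in> G"
      using rel_frontier_of_polyhedron_alt[OF \<open>polyhedron F\<close>] by blast
    then show False using min[of G] F face_of_trans face_of_imp_subset by blast
  qed
  with F that show thesis by blast
qed

lemma polytope_face_eq_hull_vertices: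
  fixes P :: "'a::euclidean_space set"
  assumes "polytope P" "F face_of P"
  shows "F = convex hull {v. v extreme_point_of P \<and> v \<in> F}"
proof -
  have "F = convex hull {v. v extreme_point_of F}"
    using assms face_of_polytope_polytope polytope_imp_compact polytope_imp_convex
      Krein_Milman_Minkowski by blast
  then show ?thesis using extreme_point_of_face[OF assms(2)] by simp
qed

section \<open>Convex sets crossing a hyperplane\<close>

lemma crosses_rel_interior:
  assumes "convex F" "crosses a t F"
  shows "rel_interior F \<inter> {x. a \<bullet> x = t} \<noteq> {}"
proof -
  have cl: "F \<subseteq> closure (rel_interior F)"
    using convex_closure_rel_interior[OF assms(1)] closure_subset by blast
  obtain x y where "x \<in> F" "a \<bullet> x < t" "y \<in> F" "t < a \<bullet> y"
    using assms(2) by (auto simp: crosses_def)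
  \<comment> \<open>The open half-spaces meet the closure of the relative interior, hence the
    relative interior itself. That set is connected, so the level \<open>t\<close> is attained in
    it.\<close>
  then have "{x. a \<bullet> x < t} \<inter> closure (rel_interior F) \<noteq> {}"
    "{x. a \<bullet> x > t} \<inter> closure (rel_interior F) \<noteq> {}" using cl by blast+
  then obtain x' y' where "x' \<in> rel_interior F" "a \<bullet> x' < t" "y' \<in> rel_interior F" "t < a \<bullet> y'"
    unfolding open_Int_closure_eq_empty[OF open_halfspace_lt]
      open_Int_closure_eq_empty[OF open_halfspace_gt] by blast
  then obtain z where "z \<in> rel_interior F" "a \<bullet> z = t"
    using connected_ivt_hyperplane[of "rel_interior F" x' y' a t]
      convex_connected[OF convex_rel_interior[OF assms(1)]] by auto
  then show ?thesis by blast
qed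

lemma rel_interior_crosses:
  assumes "convex F" "crosses a t F"
  shows "rel_interior (F \<inter> {x. a \<bullet> x = t}) = rel_interior F \<inter> {x. a \<bullet> x = t}"
  using assms crosses_rel_interior convex_affine_rel_interior_Int affine_hyperplane by blast

text \<open>Near a relative interior point on the hyperplane, \<open>F\<close> agrees with its
  affine hull. So the section has the dimension of the sliced hull, which is one less because the
  hull is not contained in the hyperplane.\<close>

lemma aff_dim_crosses:
  assumes "convex F" "crosses a t F"
  shows "aff_dim (F \<inter> {x. a \<bullet> x = t}) = aff_dim F - 1"
proof -
  let ?H = "{x. a \<bullet> x = t}"
  obtain U where U: "open U" "rel_interior F = affine hull F \<inter> U"
    using openin_rel_interior[of F] by (auto simp: openin_open)
  let ?S = "affine hull F \<inter> ?H"
  have ne: "?S \<inter> U \<noteq> {}" using crosses_rel_interior[OF assms] U(2) by blast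
  have "convex ?S" by (intro convex_Int affine_imp_convex affine_hyperplane affine_affine_hull)
  then have "affine hull (?S \<inter> U) = affine hull ?S"
    using ne U(1) by (intro affine_hull_convex_Int_open)
  then have "aff_dim (?S \<inter> U) = aff_dim ?S" by (metis aff_dim_affine_hull)
  moreover have "?S \<inter> U \<subseteq> F \<inter> ?H" using U(2) rel_interior_subset by blast
  moreover have "F \<inter> ?H \<subseteq> ?S" using hull_subset[of F affine] by blast
  ultimately have "aff_dim (F \<inter> ?H) = aff_dim ?S" by (metis aff_dim_subset order_antisym)
  moreover have "\<not> affine hull F \<subseteq> ?H"
    using assms(2) hull_subset[of F affine] by (force simp: crosses_def)
  ultimately show ?thesis
    using ne aff_dim_affine_Int_hyperplane[of "affine hull F" a t]
    by (auto simp: affine_affine_hull)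
qed

text \<open>Without crossing, the hyperplane supports \<open>F\<close> and cuts out a face of it; a
  face containing a relative interior point is everything.\<close>

lemma rel_interior_in_hyperplane:
  fixes F :: "'a::euclidean_space set"
  assumes "convex F" "x \<in> rel_interior F" "a \<bullet> x = t" "\<not> crosses a t F"
  shows "F \<subseteq> {x. a \<bullet> x = t}"
proof -
  have "(F \<inter> {x. a \<bullet> x = t}) face_of F"
  proof (cases "\<exists>x\<in>F. a \<bullet> x < t")
    case True
    then show ?thesis using assms
      by (intro face_of_Int_supporting_hyperplane_le) (force simp: crosses_def)+
  next
    case False
    then show ?thesis using assms
      by (intro face_of_Int_supporting_hyperplane_ge) force+
  qed
  moreover have "x \<in> F" using assms rel_interior_subset by blast
  ultimately show ?thesis
    using face_of_disjoint_rel_interior[of "F \<inter> {x. a \<bullet> x = t}" F] assms by blast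
qed

section \<open>Faces of a hyperplane slice\<close>

lemma face_in_hyperplane_vertex:
  fixes P :: "'a::euclidean_space set"
  assumes P: "polytope P" and inj: "inj_on (\<lambda>x. a \<bullet> x) {v. v extreme_point_of P}"
    and F: "F face_of P" "F \<noteq> {}" "F \<subseteq> {x. a \<bullet> x = t}"
  obtains v where "v extreme_point_of P" "F = {v}"
proof -
  let ?W = "{v. v extreme_point_of P \<and> v \<in> F}"
  have hull: "F = convex hull ?W" by (rule polytope_face_eq_hull_vertices[OF P F(1)])
  then have "?W \<noteq> {}" using F(2) by (metis convex_hull_empty)
  then obtain v where v: "v \<in> ?W" by blast
  \<comment> \<open>All vertices of \<open>F\<close> share the level \<open>t\<close>, so
    injectivity leaves a single one.\<close>
  have "w = v" if "w \<in> ?W" for w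
  proof (rule inj_onD[OF inj])
    show "a \<bullet> w = a \<bullet> v" using that v F(3) by auto
  qed (use that v in auto)
  then have "?W = {v}" using v by blast
  then have "F = {v}" using hull by (metis convex_hull_singleton)
  then show thesis using v that by blast
qed

lemma face_char_slice:
  fixes P :: "'a::euclidean_space set"
  assumes P: "polytope P" and inj: "inj_on (\<lambda>x. a \<bullet> x) {v. v extreme_point_of P}"
  shows "face_char (P \<inter> {x. a \<bullet> x = t}) =
    of_bool (t \<in> (\<lambda>x. a \<bullet> x) ` {v. v extreme_point_of P})
    - (\<Sum>F | F face_of P \<and> F \<noteq> {} \<and> crosses a t F. (-1) ^ nat (aff_dim F))"
proof -
  let ?H = "{x. a \<bullet> x = t}"
  let ?e = "\<lambda>F :: 'a set. (-1 :: int) ^ nat (aff_dim F)"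
  define C where "C = {F. F face_of P \<and> F \<noteq> {} \<and> crosses a t F}"
  define W where "W = {v. v extreme_point_of P \<and> a \<bullet> v = t}"
  have convH: "convex ?H" by (rule convex_hyperplane)
  have Cc: "convex F" if "F \<in> C" for F using that face_of_imp_convex by (auto simp: C_def)
  have "finite {F. F face_of P}" by (rule finite_polytope_faces[OF P])
  then have finC: "finite C" by (rule rev_finite_subset) (auto simp: C_def)
  have finW: "finite W"
    using finite_polyhedron_extreme_points[OF polytope_imp_polyhedron[OF P]]
    by (rule rev_finite_subset) (auto simp: W_def)
  have faces: "{G. G face_of P \<inter> ?H \<and> G \<noteq> {}} = (\<lambda>F. F \<inter> ?H) ` C \<union> (\<lambda>v. {v}) ` W"
  proof (intro equalityI subsetI)
    fix G assume "G \<in> {G. G face_of P \<inter> ?H \<and> G \<noteq> {}}"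
    then have G: "G face_of P \<inter> ?H" "G \<noteq> {}" by auto
    then obtain x where x: "x \<in> rel_interior G"
      using rel_interior_eq_empty face_of_imp_convex by blast
    then have xP: "x \<in> P" "x \<in> ?H" using G rel_interior_subset face_of_imp_subset by blast+
    \<comment> \<open>The face of \<open>P\<close> carrying \<open>x\<close> is the one to be
      sliced: \<open>G\<close> and \<open>F \<inter> ?H\<close> are faces of the slice whose
      relative interiors share \<open>x\<close>, so they coincide.\<close>
    obtain F where F: "F face_of P" "x \<in> rel_interior F"
      using polytope_point_in_rel_interior_face[OF P xP(1)] .
    have cF: "convex F" using F face_of_imp_convex by blast
    have "rel_interior (F \<inter> ?H) = rel_interior F \<inter> ?H"
      using xP F cF by (intro convex_affine_rel_interior_Int affine_hyperplane) auto
    then have "x \<in> rel_interior (F \<inter> ?H)" using F xP by blast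
    moreover have "(F \<inter> ?H) face_of (P \<inter> ?H)" by (rule face_of_slice[OF F(1) convH])
    ultimately have GF: "G = F \<inter> ?H" using G x by (intro face_of_eq) auto
    have Fne: "F \<noteq> {}" using F by auto
    show "G \<in> (\<lambda>F. F \<inter> ?H) ` C \<union> (\<lambda>v. {v}) ` W"
    proof (cases "crosses a t F")
      case True
      then show ?thesis using GF F(1) Fne by (auto simp: C_def)
    next
      case False
      then have FH: "F \<subseteq> ?H" using rel_interior_in_hyperplane[OF cF F(2)] xP by blast
      then obtain v where "v extreme_point_of P" "F = {v}"
        using face_in_hyperplane_vertex[OF P inj F(1) Fne] by metis
      then show ?thesis using GF FH by (auto simp: W_def)
    qed
  next
    fix G assume "G \<in> (\<lambda>F. F \<inter> ?H) ` C \<union> (\<lambda>v. {v}) ` W"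
    then show "G \<in> {G. G face_of P \<inter> ?H \<and> G \<noteq> {}}"
    proof
      assume "G \<in> (\<lambda>F. F \<inter> ?H) ` C"
      then obtain F where F: "F \<in> C" "G = F \<inter> ?H" by blast
      then have "G \<noteq> {}"
        using crosses_rel_interior[OF Cc, of F a t] rel_interior_subset[of F] by (auto simp: C_def)
      then show ?thesis using F face_of_slice[OF _ convH] by (auto simp: C_def)
    next
      assume "G \<in> (\<lambda>v. {v}) ` W"
      then obtain v where v: "v extreme_point_of P" "a \<bullet> v = t" "G = {v}" by (auto simp: W_def)
      then have "({v} \<inter> ?H) face_of (P \<inter> ?H)" by (intro face_of_slice convH) (simp add: face_of_singleton)
      then show ?thesis using v by simp
    qed
  qed
  \<comment> \<open>Equal sections give crossing faces with a common relative interior point, and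
    such faces of \<open>P\<close> are equal.\<close>
  have injC: "inj_on (\<lambda>F. F \<inter> ?H) C"
  proof (rule inj_onI)
    fix F F' assume F: "F \<in> C" "F' \<in> C" "F \<inter> ?H = F' \<inter> ?H"
    then have cr: "crosses a t F" "crosses a t F'" by (auto simp: C_def)
    have "rel_interior F \<inter> ?H = rel_interior F' \<inter> ?H"
      using F rel_interior_crosses[OF Cc cr(1)] rel_interior_crosses[OF Cc cr(2)] by simp
    then have "rel_interior F \<inter> rel_interior F' \<noteq> {}"
      using crosses_rel_interior[OF Cc cr(1)] F by blast
    then show "F = F'" using F by (intro face_of_eq[of F P F']) (auto simp: C_def)
  qed
  \<comment> \<open>A section may be a single point, but not a vertex of \<open>P\<close>: that
    point would be both extreme and relatively interior in \<open>F\<close>, forcing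
    \<open>F = {v}\<close>, which crosses nothing.\<close>
  have disj: "(\<lambda>F. F \<inter> ?H) ` C \<inter> (\<lambda>v. {v}) ` W = {}"
  proof -
    have False if F: "F \<in> C" "v \<in> W" "F \<inter> ?H = {v}" for F v
    proof -
      have cr: "crosses a t F" and FP: "F face_of P" using F by (auto simp: C_def)
      have "rel_interior F \<inter> ?H = {v}"
        using rel_interior_crosses[OF Cc[OF F(1)] cr] F(3) by simp
      then have "v \<in> rel_interior F" by blast
      moreover have "v extreme_point_of F"
        using F extreme_point_of_face[OF FP] by (auto simp: W_def)
      ultimately have "F = {v}" using extreme_point_not_in_REL_INTERIOR by blast
      then show False using cr by (auto simp: crosses_def)
    qed
    then show ?thesis by blast
  qed
  have e: "?e (F \<inter> ?H) = - ?e F" if "F \<in> C" for F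
  proof -
    have cr: "crosses a t F" "F \<noteq> {}" using that by (auto simp: C_def)
    have "F \<inter> ?H \<noteq> {}"
      using crosses_rel_interior[OF Cc[OF that] cr(1)] rel_interior_subset[of F] by blast
    then have "aff_dim (F \<inter> ?H) \<ge> 0" by (rule aff_dim_nonneg)
    moreover have "aff_dim (F \<inter> ?H) = aff_dim F - 1" by (rule aff_dim_crosses[OF Cc[OF that] cr(1)])
    ultimately have "nat (aff_dim F) = Suc (nat (aff_dim (F \<inter> ?H)))" by simp
    then show ?thesis by simp
  qed
  have cW: "int (card W) = of_bool (t \<in> (\<lambda>x. a \<bullet> x) ` {v. v extreme_point_of P})"
  proof (cases "W = {}")
    case True
    then have "t \<notin> (\<lambda>x. a \<bullet> x) ` {v. v extreme_point_of P}" by (auto simp: W_def)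
    then show ?thesis using True by simp
  next
    case False
    then obtain v where v: "v \<in> W" by blast
    then have "W = {v}" using inj by (auto simp: W_def inj_on_def)
    then show ?thesis using v by (auto simp: W_def)
  qed
  have "face_char (P \<inter> ?H) = sum ?e ((\<lambda>F. F \<inter> ?H) ` C) + sum ?e ((\<lambda>v. {v}) ` W)"
    unfolding face_char_def faces using finC finW disj by (intro sum.union_disjoint) auto
  also have "sum ?e ((\<lambda>F. F \<inter> ?H) ` C) = (\<Sum>F\<in>C. - ?e F)"
    using e by (simp add: sum.reindex[OF injC])
  also have "sum ?e ((\<lambda>v. {v}) ` W) = int (card W)"
    by (simp add: sum.reindex)
  finally show ?thesis using cW by (simp add: C_def sum_negf)
qed

section \<open>Counting levels and gaps, by induction on dimension\<close>

lemma card_half_open_eq_Suc_card_open: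
  fixes A :: "real set"
  assumes "finite A" "l \<in> A" "l < u"
  shows "card {t \<in> A. l \<le> t \<and> t < u} = Suc (card {t \<in> A. l < t \<and> t < u})"
proof -
  have "{t \<in> A. l \<le> t \<and> t < u} = insert l {t \<in> A. l < t \<and> t < u}" using assms by auto
  then show ?thesis using assms by simp
qed

theorem face_char_polytope:
  fixes P :: "'a::euclidean_space set"
  assumes "polytope P" "P \<noteq> {}"
  shows "face_char P = 1"
  using assms
proof (induction "nat (aff_dim P)" arbitrary: P rule: less_induct)
  case less
  note P = less.prems(1)
  define V where "V = {v. v extreme_point_of P}"
  have finV: "finite V"
    unfolding V_def by (rule finite_polyhedron_extreme_points[OF polytope_imp_polyhedron[OF P]])
  obtain a where inj: "inj_on (\<lambda>x. a \<bullet> x) V" using exists_inner_inj_on[OF finV] .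
  define A where "A = (\<lambda>x. a \<bullet> x) ` V"
  have finA: "finite A" by (simp add: A_def finV)
  have cardA: "card A = card V" unfolding A_def by (rule card_image[OF inj])
  define S where "S = {F. F face_of P \<and> F \<noteq> {}}"
  have finS: "finite S"
    unfolding S_def using finite_polytope_faces[OF P] by (rule rev_finite_subset) auto
  let ?e = "\<lambda>F :: 'a set. (-1 :: int) ^ nat (aff_dim F)"
  \<comment> \<open>The extreme vertex levels of \<open>F\<close>. They bound the functional on all
    of \<open>F\<close>, since \<open>F\<close> is the hull of its vertices.\<close>
  define lo where "lo F = Min ((\<lambda>x. a \<bullet> x) ` (V \<inter> F))" for F
  define hi where "hi F = Max ((\<lambda>x. a \<bullet> x) ` (V \<inter> F))" for F
  have VF: "V \<inter> F \<noteq> {}" "F = convex hull (V \<inter> F)" if "F \<in> S" for F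
  proof -
    have "V \<inter> F = {v. v extreme_point_of P \<and> v \<in> F}" by (auto simp: V_def)
    then show "F = convex hull (V \<inter> F)"
      using that polytope_face_eq_hull_vertices[OF P, of F] by (simp add: S_def)
    then show "V \<inter> F \<noteq> {}" using that by (metis (mono_tags, lifting) S_def convex_hull_empty mem_Collect_eq)
  qed
  have lo: "\<exists>v\<in>V \<inter> F. lo F = a \<bullet> v" and hi: "\<exists>v\<in>V \<inter> F. hi F = a \<bullet> v" if "F \<in> S" for F
  proof -
    have "finite (V \<inter> F)" "V \<inter> F \<noteq> {}" using finV VF(1)[OF that] by auto
    then have "lo F \<in> (\<lambda>x. a \<bullet> x) ` (V \<inter> F)" "hi F \<in> (\<lambda>x. a \<bullet> x) ` (V \<inter> F)"
      unfolding lo_def hi_def by (intro Min_in Max_in; simp)+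
    then show "\<exists>v\<in>V \<inter> F. lo F = a \<bullet> v" "\<exists>v\<in>V \<inter> F. hi F = a \<bullet> v" by blast+
  qed
  have bounds: "lo F \<le> a \<bullet> x \<and> a \<bullet> x \<le> hi F" if "F \<in> S" "x \<in> F" for F x
  proof -
    have "V \<inter> F \<subseteq> {x. a \<bullet> x \<ge> lo F} \<inter> {x. a \<bullet> x \<le> hi F}"
      using finV by (auto simp: lo_def hi_def)
    then have "convex hull (V \<inter> F) \<subseteq> {x. a \<bullet> x \<ge> lo F} \<inter> {x. a \<bullet> x \<le> hi F}"
      by (intro hull_minimal convex_Int convex_halfspace_ge convex_halfspace_le)
    then have "F \<subseteq> {x. a \<bullet> x \<ge> lo F} \<inter> {x. a \<bullet> x \<le> hi F}"
      by (rule ord_eq_le_trans[OF VF(2)[OF that(1)]])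
    then show ?thesis using that(2) by blast
  qed
  have crosses: "crosses a t F \<longleftrightarrow> lo F < t \<and> t < hi F" if "F \<in> S" for F t
  proof
    assume "crosses a t F"
    then show "lo F < t \<and> t < hi F" using bounds[OF that] unfolding crosses_def by force
  next
    assume "lo F < t \<and> t < hi F"
    then show "crosses a t F" using lo[OF that] hi[OF that] unfolding crosses_def by force
  qed
  have loA: "lo F \<in> A" and hiA: "hi F \<in> A" and le: "lo F \<le> hi F" if "F \<in> S" for F
    using lo[OF that] hi[OF that] bounds[OF that] by (auto simp: A_def)
  have PS: "P \<in> S" using less.prems face_of_refl polytope_imp_convex by (auto simp: S_def)
  have APb: "lo P \<le> t \<and> t \<le> hi P" if "t \<in> A" for t
    using that bounds[OF PS] by (auto simp: A_def V_def extreme_point_of_def)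
  have sub: "lo P \<le> lo F" "hi F \<le> hi P" if "F \<in> S" for F
    using APb[OF loA[OF that]] APb[OF hiA[OF that]] by auto
  have sing: "{F \<in> S. lo F = hi F} = (\<lambda>v. {v}) ` V"
  proof (intro equalityI subsetI)
    fix F assume "F \<in> {F \<in> S. lo F = hi F}"
    then have F: "F \<in> S" "lo F = hi F" by auto
    then have "F \<subseteq> {x. a \<bullet> x = lo F}" using bounds[OF F(1)] by force
    then obtain v where "v extreme_point_of P" "F = {v}"
      using face_in_hyperplane_vertex[OF P inj[unfolded V_def], of F] F by (auto simp: S_def)
    then show "F \<in> (\<lambda>v. {v}) ` V" by (auto simp: V_def)
  next
    fix F assume "F \<in> (\<lambda>v. {v}) ` V"
    then obtain v where v: "v \<in> V" "F = {v}" by blast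
    then have "F \<in> S" by (auto simp: S_def V_def face_of_singleton)
    with v lo[of F] hi[of F] show "F \<in> {F \<in> S. lo F = hi F}" by auto
  qed
  have slice: "(\<Sum>F | F \<in> S \<and> lo F < t \<and> t < hi F. ?e F) = of_bool (t \<in> A) - 1"
    if t: "lo P \<le> t" "t \<le> hi P" and lt: "lo P < hi P" for t
  proof -
    let ?Q = "P \<inter> {x. a \<bullet> x = t}"
    have cP: "convex P" "connected P" using P polytope_imp_convex convex_connected by blast+
    obtain v w where vw: "v \<in> P" "w \<in> P" "lo P = a \<bullet> v" "hi P = a \<bullet> w" using lo[OF PS] hi[OF PS] by blast
    then have Qne: "?Q \<noteq> {}"
      using connected_ivt_hyperplane[OF cP(2), of v w a t] t by auto
    have Qd: "aff_dim ?Q < aff_dim P"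
    proof (cases "crosses a t P")
      case True
      then show ?thesis using aff_dim_crosses[OF cP(1)] by simp
    next
      case False
      have ne: "?Q \<noteq> P"
      proof
        assume "?Q = P"
        then have "v \<in> ?Q" "w \<in> ?Q" using vw by simp_all
        then show False using vw lt by simp
      qed
      \<comment> \<open>At an extreme level the slice is a supporting face;
        \<open>lo P < hi P\<close> makes it proper, so its dimension drops here too and the
        induction hypothesis applies.\<close>
      have "t = lo P \<or> t = hi P" using False t crosses[OF PS] by auto
      then have "?Q face_of P"
        using bounds[OF PS] cP(1)
        by (metis face_of_Int_supporting_hyperplane_ge face_of_Int_supporting_hyperplane_le)
      then show ?thesis using ne cP(1) face_of_aff_dim_lt by blast
    qed
    moreover have "aff_dim ?Q \<ge> 0" using Qne by (rule aff_dim_nonneg)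
    moreover have "polytope ?Q" by (intro polytope_Int_polyhedron P polyhedron_hyperplane)
    ultimately have "face_char ?Q = 1" using Qne by (intro less.hyps) auto
    moreover have "{F. F face_of P \<and> F \<noteq> {} \<and> crosses a t F} = {F. F \<in> S \<and> lo F < t \<and> t < hi F}"
      using crosses by (auto simp: S_def)
    ultimately show ?thesis
      using face_char_slice[OF P inj[unfolded V_def], of t] by (simp add: A_def V_def)
  qed
  have T: "(\<Sum>F | F \<in> S \<and> lo F < t \<and> t < hi F. ?e F) = 0" if "t \<in> A" for t
  proof (cases "lo P < hi P")
    case True
    then show ?thesis using slice[of t] APb[OF that] that by simp
  next
    case False
    \<comment> \<open>Here \<open>lo P = hi P\<close>, so no face crosses any level.\<close>
    then have "\<not> (lo F < t \<and> t < hi F)" if "F \<in> S" for F using sub[OF that] by linarith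
    then have empty: "{F. F \<in> S \<and> lo F < t \<and> t < hi F} = {}" by blast
    show ?thesis unfolding empty by simp
  qed
  \<comment> \<open>Each gap is indexed by its lower endpoint \<open>t\<close>: a face crosses the
    gap iff \<open>lo F \<le> t\<close> and \<open>t < hi F\<close>. No gap starts at the top level,
    hence the \<open>of_bool\<close> term.\<close>
  have U: "(\<Sum>F | F \<in> S \<and> lo F \<le> t \<and> t < hi F. ?e F) = of_bool (t = hi P) - 1" if tA: "t \<in> A" for t
  proof (cases "t = hi P")
    case True
    then have "\<not> t < hi F" if "F \<in> S" for F using sub[OF that] by linarith
    then have empty: "{F. F \<in> S \<and> lo F \<le> t \<and> t < hi F} = {}" by blast
    show ?thesis unfolding empty by (simp add: True)
  next
    case False
    then have thi: "t < hi P" using APb[OF tA] by simp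
    \<comment> \<open>The faces in question are those crossing a level strictly between \<open>t\<close> and the next vertex level.\<close>
    define u where "u = Min {r \<in> A. t < r}"
    have ne: "{r \<in> A. t < r} \<noteq> {}" using thi hiA[OF PS] by blast
    have u: "u \<in> A" "t < u" using Min_in[OF _ ne] finA by (auto simp: u_def)
    have umin: "u \<le> r" if "r \<in> A" "t < r" for r using that finA by (simp add: u_def)
    define s where "s = (t + u) / 2"
    have s: "t < s" "s < u" using u by (auto simp: s_def)
    have "s \<notin> A" using umin[of s] s by auto
    have "lo F \<le> t \<and> t < hi F \<longleftrightarrow> lo F < s \<and> s < hi F" if "F \<in> S" for F
      using umin[OF loA[OF that]] umin[OF hiA[OF that]] s by linarith
    then have eq: "{F. F \<in> S \<and> lo F \<le> t \<and> t < hi F} = {F. F \<in> S \<and> lo F < s \<and> s < hi F}"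
      by blast
    show ?thesis unfolding eq
      using slice[of s] APb[OF tA] APb[OF u(1)] s thi False \<open>s \<notin> A\<close> by simp
  qed
  have swap: "(\<Sum>F\<in>S. ?e F * int (card {t \<in> A. R F t})) = (\<Sum>t\<in>A. \<Sum>F | F \<in> S \<and> R F t. ?e F)" for R
  proof -
    have "(\<Sum>F\<in>S. ?e F * int (card {t \<in> A. R F t})) = (\<Sum>F\<in>S. \<Sum>t | t \<in> A \<and> R F t. ?e F)"
      by (simp add: mult.commute)
    also have "\<dots> = (\<Sum>t\<in>A. \<Sum>F | F \<in> S \<and> R F t. ?e F)"
      by (rule sum.swap_restrict[OF finS finA])
    finally show ?thesis .
  qed
  \<comment> \<open>The two cardinalities count the gaps and the vertex levels that \<open>F\<close>
    crosses. Their difference is 1 if \<open>lo F < hi F\<close>; for a vertex both vanish and the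
    \<open>of_bool\<close> term supplies its sign.\<close>
  have "?e F = of_bool (lo F = hi F) * ?e F + ?e F * int (card {t \<in> A. lo F \<le> t \<and> t < hi F})
      - ?e F * int (card {t \<in> A. lo F < t \<and> t < hi F})" if "F \<in> S" for F
  proof (cases "lo F = hi F")
    case True
    then have empty: "{t \<in> A. lo F \<le> t \<and> t < hi F} = {}" "{t \<in> A. lo F < t \<and> t < hi F} = {}" by auto
    show ?thesis unfolding empty by (simp add: True)
  next
    case False
    then show ?thesis
      using card_half_open_eq_Suc_card_open[OF finA loA[OF that], of "hi F"] le[OF that]
      by (simp add: algebra_simps)
  qed
  then have "face_char P = (\<Sum>F\<in>S. of_bool (lo F = hi F) * ?e F
      + ?e F * int (card {t \<in> A. lo F \<le> t \<and> t < hi F})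
      - ?e F * int (card {t \<in> A. lo F < t \<and> t < hi F}))"
    unfolding face_char_def S_def[symmetric] by (rule sum.cong[OF refl])
  also have "\<dots> = (\<Sum>F\<in>S. of_bool (lo F = hi F) * ?e F)
      + (\<Sum>t\<in>A. \<Sum>F | F \<in> S \<and> lo F \<le> t \<and> t < hi F. ?e F)
      - (\<Sum>t\<in>A. \<Sum>F | F \<in> S \<and> lo F < t \<and> t < hi F. ?e F)"
    by (simp only: sum.distrib sum_subtractf swap)
  \<comment> \<open>The sums over vertex levels vanish by \<open>T\<close>; by \<open>U\<close>
    every level except the top one contributes -1.\<close>
  also have "\<dots> = (\<Sum>F\<in>S. of_bool (lo F = hi F) * ?e F) + (\<Sum>t\<in>A. of_bool (t = hi P) - 1)"
    using T U by simp
  also have "(\<Sum>F\<in>S. of_bool (lo F = hi F) * ?e F) = (\<Sum>F | F \<in> S \<and> lo F = hi F. ?e F)"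
    using finS by (intro sum.mono_neutral_cong_right) auto
  also have "\<dots> = int (card V)" by (simp add: sing sum.reindex)
  also have "(\<Sum>t\<in>A. of_bool (t = hi P) - 1) = 1 - int (card A)"
    using finA hiA[OF PS] by (simp add: sum_subtractf of_bool_def)
  finally show ?case using cardA by simp
qed

section \<open>Euler's formula in dimension three\<close>

theorem theorem1p1:
  fixes K :: "(real^3) set" and n0 n1 n2 :: nat
  assumes "convex_polyhedron K"
    and "n0 = card {v. v extreme_point_of K}"
    and "n1 = card {e. e edge_of K}"
    and "n2 = card {F. F polygon_of K}"
  shows "int n0 - int n1 + int n2 = 2"
proof -
  have K: "polytope K" "aff_dim K = 3" using assms(1) convex_polyhedron_iff_polytope by auto
  have cK: "convex K" and Kne: "K \<noteq> {}" using K polytope_imp_convex by auto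
  have fin: "finite {F. F face_of K}" by (rule finite_polytope_faces[OF K(1)])
  define D where "D i = {F. F face_of K \<and> aff_dim F = i}" for i
  have finD: "finite (D i)" for i using fin by (rule rev_finite_subset) (auto simp: D_def)
  have D0: "D 0 = (\<lambda>v. {v}) ` {v. v extreme_point_of K}"
    by (auto simp: D_def aff_dim_eq_0 face_of_singleton)
  have c0: "card (D 0) = n0" unfolding D0 assms(2) by (intro card_image) auto
  have c1: "card (D 1) = n1" unfolding assms(3) D_def edge_of_def ..
  have c2: "card (D 2) = n2" unfolding assms(4) D_def polygon_of_def ..
  have D3: "D 3 = {K}"
    using K cK face_of_refl face_of_aff_dim_lt[OF cK] by (fastforce simp: D_def)
  have "{F. F face_of K \<and> F \<noteq> {}} = D 0 \<union> (D 1 \<union> (D 2 \<union> D 3))"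
  proof -
    have "aff_dim F = 0 \<or> aff_dim F = 1 \<or> aff_dim F = 2 \<or> aff_dim F = 3"
      if "F face_of K" "F \<noteq> {}" for F
    proof -
      have "0 \<le> aff_dim F" using that(2) by (rule aff_dim_nonneg)
      moreover have "aff_dim F \<le> 3" using that aff_dim_subset face_of_imp_subset K(2) by metis
      ultimately show ?thesis by presburger
    qed
    then show ?thesis by (auto simp: D_def)
  qed
  moreover have "D i \<inter> D j = {}" if "i \<noteq> j" for i j using that by (auto simp: D_def)
  ultimately have "face_char K = (\<Sum>F\<in>D 0. (-1) ^ nat (aff_dim F)) + ((\<Sum>F\<in>D 1. (-1) ^ nat (aff_dim F))
      + ((\<Sum>F\<in>D 2. (-1) ^ nat (aff_dim F)) + (\<Sum>F\<in>D 3. (-1) ^ nat (aff_dim F))))"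
    unfolding face_char_def by (simp add: finD sum.union_disjoint Int_Un_distrib)
  moreover have "(\<Sum>F\<in>D i. (-1) ^ nat (aff_dim F)) = (-1 :: int) ^ nat i * int (card (D i))" for i
    by (simp add: D_def)
  \<comment> \<open>The final -1 is the sign of the three-dimensional face \<open>K\<close> itself;
    moved across \<open>face_char K = 1\<close>, it yields 2.\<close>
  ultimately have "face_char K = int n0 - int n1 + int n2 - 1"
    by (simp add: c0 c1 c2 D3 K(2))
  then show ?thesis using face_char_polytope[OF K(1) Kne] by simp
qed

end
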